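(* Let $\sigma = 10$, $\rho = 28$, $\beta = 8/3$, and let $\alpha_1,\alpha_2 \in \mathbb{R}$ satisfy $\alpha_1+\alpha_2 > 15.1$. Let $(x_1,y_1,z_1,x_2,y_2,z_2):[0,\infty)\to\mathbb{R}^6$ be a solution of the coupled Lorenz system $$ \begin{cases} \dot{x}_1 = \sigma(y_1 - x_1) + \alpha_1(x_2 - x_1) \\ \dot{y}_1 = x_1(\rho - z_1) - y_1 + \alpha_1(y_2 - y_1) \\ \dot{z}_1 = x_1y_1 - \beta z_1 + \alpha_1(z_2 - z_1) \\ \dot{x}_2 = \sigma(y_2 - x_2) + \alpha_2(x_1 - x_2) \\ \dot{y}_2 = x_2(\rho - z_2) - y_2 + \alpha_2(y_1 - y_2) \\ \dot{z}_2 = x_2y_2 - \beta z_2 + \alpha_2(z_1 - z_2) \end{cases} $$ such that $0 \le z_2(t) \le 48$ and $-28 \le y_2(t) \le 28$ for all $t \ge 0$. Then the two subsystems synchronize completely: $$ \lim_{t\to\infty}|x_1(t)-x_2(t)| = 0,\qquad \lim_{t\to\infty}|y_1(t)-y_2(t)| = 0,\qquad \lim_{t\to\infty}|z_1(t)-z_2(t)| = 0 . $$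
   Context: The system consists of two identical Lorenz oscillators with states $(x_1,y_1,z_1)$ and $(x_2,y_2,z_2)$, joined by asymmetric bidirectional diffusive coupling with independent real coupling coefficients $\alpha_1,\alpha_2$. Dots denote derivatives with respect to time $t$. Complete synchronization means that the errors $x_2-x_1$, $y_2-y_1$, $z_2-z_1$ all tend to $0$ as $t\to\infty$. *)

theory Defs
  imports "HOL-Analysis.Analysis"
begin

end

theory Submission
  imports Defs
begin

text \<open>
  Write \<open>(X, Y, Z)\<close> for the synchronization error, first oscillator minus second, and
  \<open>k = \<alpha>\<^sub>1 + \<alpha>\<^sub>2\<close>.  The idea is that \<open>V = 2 X\<^sup>2 + Y\<^sup>2 + Z\<^sup>2\<close> is a Lyapunov function for the error.
  The coupling enters the error equation only through the damping \<open>- k (X, Y, Z)\<close>.  In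
  \<open>V'\<close> the cubic terms \<open>X Y Z\<close> and the terms \<open>x\<^sub>2 Y Z\<close> cancel, because \<open>Y\<^sup>2\<close> and \<open>Z\<^sup>2\<close> carry the
  same weight; hence \<open>x\<^sub>2\<close>, over which there is no control, drops out, and
  \<open>V' / 2\<close> is a quadratic form in \<open>(X, Y, Z)\<close> whose only off-diagonal coefficients are \<open>48 - z\<^sub>2\<close> (for \<open>X Y\<close>) and \<open>y\<^sub>2\<close> (for \<open>X Z\<close>).

  The weight of \<open>X\<^sup>2\<close> matters: with weight \<open>1\<close> the form is not negative definite at
  \<open>k = 15.1\<close> for all admissible \<open>y\<^sub>2\<close> and \<open>z\<^sub>2\<close>, whereas with weight \<open>2\<close> it is at most \<open>- V / 10\<close>
  (\<open>error_form_le\<close>).  So \<open>V' \<le> - V / 5\<close>, and \<open>V\<close> decays exponentially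
  (\<open>exponential_decay\<close>).
\<close>

text \<open>The function \<open>exp (c t) V t\<close> is nonincreasing.\<close>

lemma exponential_decay:
  fixes V V' :: "real \<Rightarrow> real"
  assumes deriv: "\<And>t. t \<ge> 0 \<Longrightarrow> (V has_real_derivative V' t) (at t within {0..})"
    and le: "\<And>t. t \<ge> 0 \<Longrightarrow> V' t \<le> - c * V t"
    and "t \<ge> 0"
  shows "V t \<le> exp (- c * t) * V 0"
proof -
  define W where "W = (\<lambda>s. exp (c * s) * V s)"
  have W': "(W has_real_derivative exp (c * s) * (V' s + c * V s)) (at s within {0..})"
    if "s \<ge> 0" for s
    unfolding W_def
    by (rule deriv [OF that] refl derivative_eq_intros)+ (simp add: algebra_simps)
  have "W t \<le> W 0"
  proof (rule DERIV_nonpos_imp_decreasing_open [where f = W, OF \<open>t \<ge> 0\<close>])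
    fix s :: real assume s: "0 < s" "s < t"
    have "(W has_real_derivative exp (c * s) * (V' s + c * V s)) (at s)"
      using W' [of s] s at_within_interior [of s "{0..}"] by simp
    moreover have "exp (c * s) * (V' s + c * V s) \<le> 0"
      using le [of s] s by (simp add: mult_le_0_iff)
    ultimately show "\<exists>y. (W has_real_derivative y) (at s) \<and> y \<le> 0" by blast
  next
    have "continuous_on {0..} W"
      by (rule DERIV_continuous_on) (use W' in auto)
    then show "continuous_on {0..t} W"
      by (rule continuous_on_subset) auto
  qed
  then have "exp (- c * t) * (exp (c * t) * V t) \<le> exp (- c * t) * V 0"
    by (intro mult_left_mono) (simp_all add: W_def)
  then show ?thesis
    by (simp add: mult.assoc [symmetric] exp_add [symmetric])
qed

lemma abs_tendsto_zero_if_square_le: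
  fixes f V :: "real \<Rightarrow> real"
  assumes "(V \<longlongrightarrow> 0) F" and "\<forall>\<^sub>F t in F. (f t)\<^sup>2 \<le> V t"
  shows "((\<lambda>t. \<bar>f t\<bar>) \<longlongrightarrow> 0) F"
proof -
  have "((\<lambda>t. (f t)\<^sup>2) \<longlongrightarrow> 0) F"
    by (rule tendsto_sandwich [OF _ assms(2) tendsto_const assms(1)]) simp
  from tendsto_real_sqrt [OF this] show ?thesis by simp
qed

lemma mult_le_weighted_squares:
  fixes b p q u v :: real
  assumes "\<bar>b\<bar> \<le> 2 * p * q"
  shows "b * u * v \<le> p\<^sup>2 * u\<^sup>2 + q\<^sup>2 * v\<^sup>2"
proof -
  have "b * u * v \<le> \<bar>b\<bar> * (\<bar>u\<bar> * \<bar>v\<bar>)"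
    by (metis abs_ge_self abs_mult mult.assoc)
  also have "\<dots> \<le> 2 * p * q * (\<bar>u\<bar> * \<bar>v\<bar>)"
    using assms by (intro mult_right_mono) auto
  also have "\<dots> \<le> p\<^sup>2 * u\<^sup>2 + q\<^sup>2 * v\<^sup>2"
    using sum_squares_bound [of "p * \<bar>u\<bar>" "q * \<bar>v\<bar>"]
    by (simp add: power_mult_distrib algebra_simps)
  finally show ?thesis .
qed

text \<open>
  The left-hand side is \<open>V' / 2\<close> along the error dynamics.  Completing squares needs
  \<open>(48 - z)\<^sup>2 / (4 (k + 1)) + y\<^sup>2 / (4 (k + 8/3)) < 2 (k + 10)\<close>, which holds with some room for all
  admissible \<open>y\<close> and \<open>z\<close> already when \<open>k = 15.1\<close>.
\<close>

lemma error_form_le: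
  fixes k y z X Y Z :: real
  assumes k: "k \<ge> 15.1" and z: "0 \<le> z" "z \<le> 48" and y: "-28 \<le> y" "y \<le> 28"
  shows "- 2 * (k + 10) * X\<^sup>2 - (k + 1) * Y\<^sup>2 - (k + 8 / 3) * Z\<^sup>2 + (48 - z) * X * Y + y * X * Z
         \<le> - (1 / 10) * (2 * X\<^sup>2 + Y\<^sup>2 + Z\<^sup>2)"
proof -
  \<comment> \<open>\<open>4\<^sup>2\<close> and \<open>(21/5)\<^sup>2\<close> do not exceed \<open>k + 1 - 1/10\<close> and \<open>k + 8/3 - 1/10\<close>; the price
     \<open>6\<^sup>2 + (10/3)\<^sup>2\<close> on \<open>X\<^sup>2\<close> stays below \<open>2 (k + 10) - 1/5\<close>.\<close>
  have "(48 - z) * X * Y \<le> 36 * X\<^sup>2 + 16 * Y\<^sup>2"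
    using mult_le_weighted_squares [of "48 - z" 6 4 X Y] z by simp
  moreover have "y * X * Z \<le> 100 / 9 * X\<^sup>2 + 441 / 25 * Z\<^sup>2"
    using mult_le_weighted_squares [of y "10 / 3" "21 / 5" X Z] y by (simp add: power_divide)
  moreover have "15.1 * X\<^sup>2 \<le> k * X\<^sup>2" "15.1 * Y\<^sup>2 \<le> k * Y\<^sup>2" "15.1 * Z\<^sup>2 \<le> k * Z\<^sup>2"
    by (rule mult_right_mono [OF k zero_le_power2])+
  moreover have "0 \<le> X\<^sup>2" "0 \<le> Y\<^sup>2" "0 \<le> Z\<^sup>2" by auto
  ultimately show ?thesis
    unfolding ring_distribs by linarith
qed

theorem mainTheorem1:
  fixes \<sigma> \<rho> \<beta> \<alpha>\<^sub>1 \<alpha>\<^sub>2 :: real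
    and x\<^sub>1 y\<^sub>1 z\<^sub>1 x\<^sub>2 y\<^sub>2 z\<^sub>2 :: "real \<Rightarrow> real"
  assumes "\<sigma> = 10" and "\<rho> = 28" and "\<beta> = 8 / 3"
    and "\<alpha>\<^sub>1 + \<alpha>\<^sub>2 > 15.1"
    and "\<And>t. t \<ge> 0 \<Longrightarrow> (x\<^sub>1 has_real_derivative
           \<sigma> * (y\<^sub>1 t - x\<^sub>1 t) + \<alpha>\<^sub>1 * (x\<^sub>2 t - x\<^sub>1 t)) (at t within {0..})"
    and "\<And>t. t \<ge> 0 \<Longrightarrow> (y\<^sub>1 has_real_derivative
           x\<^sub>1 t * (\<rho> - z\<^sub>1 t) - y\<^sub>1 t + \<alpha>\<^sub>1 * (y\<^sub>2 t - y\<^sub>1 t)) (at t within {0..})"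
    and "\<And>t. t \<ge> 0 \<Longrightarrow> (z\<^sub>1 has_real_derivative
           x\<^sub>1 t * y\<^sub>1 t - \<beta> * z\<^sub>1 t + \<alpha>\<^sub>1 * (z\<^sub>2 t - z\<^sub>1 t)) (at t within {0..})"
    and "\<And>t. t \<ge> 0 \<Longrightarrow> (x\<^sub>2 has_real_derivative
           \<sigma> * (y\<^sub>2 t - x\<^sub>2 t) + \<alpha>\<^sub>2 * (x\<^sub>1 t - x\<^sub>2 t)) (at t within {0..})"
    and "\<And>t. t \<ge> 0 \<Longrightarrow> (y\<^sub>2 has_real_derivative
           x\<^sub>2 t * (\<rho> - z\<^sub>2 t) - y\<^sub>2 t + \<alpha>\<^sub>2 * (y\<^sub>1 t - y\<^sub>2 t)) (at t within {0..})"
    and "\<And>t. t \<ge> 0 \<Longrightarrow> (z\<^sub>2 has_real_derivative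
           x\<^sub>2 t * y\<^sub>2 t - \<beta> * z\<^sub>2 t + \<alpha>\<^sub>2 * (z\<^sub>1 t - z\<^sub>2 t)) (at t within {0..})"
    and "\<And>t. t \<ge> 0 \<Longrightarrow> 0 \<le> z\<^sub>2 t \<and> z\<^sub>2 t \<le> 48"
    and "\<And>t. t \<ge> 0 \<Longrightarrow> -28 \<le> y\<^sub>2 t \<and> y\<^sub>2 t \<le> 28"
  shows "((\<lambda>t. \<bar>x\<^sub>1 t - x\<^sub>2 t\<bar>) \<longlongrightarrow> 0) at_top \<and>
         ((\<lambda>t. \<bar>y\<^sub>1 t - y\<^sub>2 t\<bar>) \<longlongrightarrow> 0) at_top \<and>
         ((\<lambda>t. \<bar>z\<^sub>1 t - z\<^sub>2 t\<bar>) \<longlongrightarrow> 0) at_top"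
proof -
  note params = assms(1-3)
  define k where "k = \<alpha>\<^sub>1 + \<alpha>\<^sub>2"
  define X where "X = (\<lambda>t. x\<^sub>1 t - x\<^sub>2 t)"
  define Y where "Y = (\<lambda>t. y\<^sub>1 t - y\<^sub>2 t)"
  define Z where "Z = (\<lambda>t. z\<^sub>1 t - z\<^sub>2 t)"
  define V where "V = (\<lambda>t. 2 * (X t)\<^sup>2 + (Y t)\<^sup>2 + (Z t)\<^sup>2)"
  define Q where "Q = (\<lambda>t. - 2 * (k + 10) * (X t)\<^sup>2 - (k + 1) * (Y t)\<^sup>2 - (k + 8 / 3) * (Z t)\<^sup>2
    + (48 - z\<^sub>2 t) * X t * Y t + y\<^sub>2 t * X t * Z t)"
  have dX: "(X has_real_derivative 10 * (Y t - X t) - k * X t) (at t within {0..})"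
    if "t \<ge> 0" for t
    unfolding X_def Y_def k_def
    by (rule DERIV_cong [OF DERIV_diff [OF assms(5) [OF that] assms(8) [OF that]]])
      (simp add: params algebra_simps)
  \<comment> \<open>Eliminating the first oscillator leaves \<open>x\<^sub>2\<close>, \<open>y\<^sub>2\<close>, \<open>z\<^sub>2\<close> as coefficients of a quadratic
     error equation.\<close>
  have dY: "(Y has_real_derivative
      28 * X t - X t * Z t - z\<^sub>2 t * X t - x\<^sub>2 t * Z t - Y t - k * Y t) (at t within {0..})"
    if "t \<ge> 0" for t
    unfolding X_def Y_def Z_def k_def
    by (rule DERIV_cong [OF DERIV_diff [OF assms(6) [OF that] assms(9) [OF that]]])
      (simp add: params algebra_simps)
  have dZ: "(Z has_real_derivative
      X t * Y t + y\<^sub>2 t * X t + x\<^sub>2 t * Y t - 8 / 3 * Z t - k * Z t) (at t within {0..})"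
    if "t \<ge> 0" for t
    unfolding X_def Y_def Z_def k_def
    by (rule DERIV_cong [OF DERIV_diff [OF assms(7) [OF that] assms(10) [OF that]]])
      (simp add: params field_simps)
  have dV: "(V has_real_derivative 2 * Q t) (at t within {0..})" if "t \<ge> 0" for t
    unfolding V_def Q_def
    by (rule dX [OF that] dY [OF that] dZ [OF that] refl derivative_eq_intros)+
      (simp add: algebra_simps power2_eq_square)
  have "2 * Q t \<le> - (1 / 5) * V t" if "t \<ge> 0" for t
    using error_form_le [of k "z\<^sub>2 t" "y\<^sub>2 t" "X t" "Y t" "Z t"] assms(4) assms(11,12) [OF that]
    unfolding Q_def V_def k_def by simp
  then have decay: "V t \<le> exp (- (1 / 5) * t) * V 0" if "t \<ge> 0" for t
    using exponential_decay [of V "\<lambda>t. 2 * Q t" "1 / 5" t] dV that by blast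
  have lim: "((\<lambda>t. exp (- (1 / 5) * t) * V 0) \<longlongrightarrow> 0) at_top"
  proof -
    have "((\<lambda>t::real. exp (- (1 / 5) * t)) \<longlongrightarrow> 0) at_top"
      by (intro filterlim_compose [OF exp_at_bot]
          filterlim_tendsto_neg_mult_at_bot [OF tendsto_const] filterlim_ident) simp
    from tendsto_mult_left_zero [OF this] show ?thesis .
  qed
  have "(X t)\<^sup>2 \<le> exp (- (1 / 5) * t) * V 0 \<and> (Y t)\<^sup>2 \<le> exp (- (1 / 5) * t) * V 0
      \<and> (Z t)\<^sup>2 \<le> exp (- (1 / 5) * t) * V 0" if "t \<ge> 0" for t
    using decay [OF that] zero_le_power2 [of "X t"] zero_le_power2 [of "Y t"]
      zero_le_power2 [of "Z t"] unfolding V_def by linarith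
  then have "\<forall>\<^sub>F t in at_top. (X t)\<^sup>2 \<le> exp (- (1 / 5) * t) * V 0"
    and "\<forall>\<^sub>F t in at_top. (Y t)\<^sup>2 \<le> exp (- (1 / 5) * t) * V 0"
    and "\<forall>\<^sub>F t in at_top. (Z t)\<^sup>2 \<le> exp (- (1 / 5) * t) * V 0"
    by (auto intro: eventually_mono [OF eventually_ge_at_top [of 0]])
  from this [THEN abs_tendsto_zero_if_square_le [OF lim]] show ?thesis
    unfolding X_def Y_def Z_def by blast
qed

end
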